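(* Let $m\le n$, let $A\in\mathbb{R}^{n\times n}$ be symmetric positive definite, let $B,C\in\mathbb{R}^{m\times n}$ satisfy $\operatorname{rank}(B)=\operatorname{rank}(C)=m$, and suppose $C=kB$ for some real $k>0$. Then $\rho(M_\alpha)<1$ for all $\alpha>0$. Consequently, for every $\alpha>0$ the shift-splitting (SS) iteration with parameter $\alpha$ converges, for every initial vector $\mathbf{x}^{(0)}\in\mathbb{R}^{n+m}$, to the unique solution of $\mathcal{A}\mathbf{x}=\mathbf{f}$.
   Context: $\rho(\cdot)$ denotes the spectral radius. The saddle point matrix is $$\mathcal{A}=\begin{bmatrix}A&B^T\\-C&0\end{bmatrix}\in\mathbb{R}^{(n+m)\times(n+m)},$$ and $\mathbf{f}\in\mathbb{R}^{n+m}$ is a given right-hand side. For $\alpha>0$ the SS iteration is $$(\alpha I+\mathcal{A})\mathbf{x}^{(k+1)}=(\alpha I-\mathcal{A})\mathbf{x}^{(k)}+2\mathbf{f},\quad k=0,1,2,\ldots$$ (here the superscript $k$ is the iteration index, unrelated to the scalar in $C=kB$), and its iteration matrix is $M_\alpha=(\alpha I+\mathcal{A})^{-1}(\alpha I-\mathcal{A})$ (the matrix $\alpha I+\mathcal{A}$ is nonsingular under the stated assumptions). *)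

theory Defs
  imports Complex_Main
    "Jordan_Normal_Form.Spectral_Radius"
    "Jordan_Normal_Form.DL_Rank"
    "Jordan_Normal_Form.Gauss_Jordan_Elimination"
begin

definition sym_pos_def :: "nat \<Rightarrow> real mat \<Rightarrow> bool" where
  "sym_pos_def n A \<longleftrightarrow>
     A \<in> carrier_mat n n \<and> transpose_mat A = A \<and>
     (\<forall>v \<in> carrier_vec n. v \<noteq> 0\<^sub>v n \<longrightarrow> v \<bullet> (A *\<^sub>v v) > 0)"

text \<open>For \<open>A\<close> of size \<open>n\<close> by \<open>n\<close> and \<open>B\<close>, \<open>C\<close> of size \<open>m\<close> by \<open>n\<close>, so that the zero block is
  \<open>m\<close> by \<open>m\<close>.\<close>

definition saddle_point_mat :: "real mat \<Rightarrow> real mat \<Rightarrow> real mat \<Rightarrow> real mat" where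
  "saddle_point_mat A B C =
     four_block_mat A (transpose_mat B) (- C) (0\<^sub>m (dim_row C) (dim_row B))"

definition shift_plus :: "real \<Rightarrow> real mat \<Rightarrow> real mat" where
  "shift_plus \<alpha> S = \<alpha> \<cdot>\<^sub>m 1\<^sub>m (dim_row S) + S"

definition shift_minus :: "real \<Rightarrow> real mat \<Rightarrow> real mat" where
  "shift_minus \<alpha> S = \<alpha> \<cdot>\<^sub>m 1\<^sub>m (dim_row S) - S"

text \<open>\<open>mat_inverse\<close> is option-valued; the matrix below is meaningful only if
  \<open>shift_plus \<alpha> S\<close> is invertible.\<close>

definition SS_iteration_mat :: "real \<Rightarrow> real mat \<Rightarrow> real mat" where
  "SS_iteration_mat \<alpha> S = the (mat_inverse (shift_plus \<alpha> S)) * shift_minus \<alpha> S"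

text \<open>The library's spectral radius is defined for complex matrices; the eigenvalues of a
  real matrix are taken over the complex numbers. For the matrix of size 0 its value is
  unspecified.\<close>

definition real_spectral_radius :: "real mat \<Rightarrow> real" where
  "real_spectral_radius M = spectral_radius (map_mat complex_of_real M)"

definition SS_iteration ::
    "real \<Rightarrow> real mat \<Rightarrow> real vec \<Rightarrow> real vec \<Rightarrow> (nat \<Rightarrow> real vec) \<Rightarrow> bool" where
  "SS_iteration \<alpha> S f x0 x \<longleftrightarrow>
     x 0 = x0 \<and>
     (\<forall>k. x k \<in> carrier_vec (dim_row S)) \<and>
     (\<forall>k. shift_plus \<alpha> S *\<^sub>v x (Suc k) = shift_minus \<alpha> S *\<^sub>v x k + 2 \<cdot>\<^sub>v f)"

text \<open>The type of vectors with dynamic dimension carries no topology, so convergence is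
  convergence in the product topology, i.e. in every coordinate.\<close>

definition vec_tendsto :: "(nat \<Rightarrow> real vec) \<Rightarrow> real vec \<Rightarrow> bool" where
  "vec_tendsto x l \<longleftrightarrow>
     (\<forall>k. dim_vec (x k) = dim_vec l) \<and>
     (\<forall>i < dim_vec l. (\<lambda>k. x k $ i) \<longlonglongrightarrow> l $ i)"

end

theory Submission
  imports Defs
begin

text \<open>For an eigenpair \<open>(\<lambda>, (x, y))\<close> of the saddle point matrix with \<open>C = k B\<close>, pairing in the inner
  product weighted by \<open>k\<close> on the first block makes the off-diagonal blocks skew, so
  \<open>Re \<lambda> (k |x|\<^sup>2 + |y|\<^sup>2) = k x\<^sup>* A x\<close>. If \<open>Re \<lambda> \<le> 0\<close> this forces \<open>x = 0\<close>, then
  \<open>B\<^sup>T y = 0\<close>, and \<open>y = 0\<close> by full row rank; hence all eigenvalues lie in the open right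
  half-plane. An eigenvalue \<open>\<mu>\<close> of the iteration matrix gives the eigenvalue
  \<open>\<alpha> (1 - \<mu>) / (1 + \<mu>)\<close> of the saddle point matrix, whose positive real part means \<open>|\<mu>| < 1\<close>.\<close>

section \<open>Real and imaginary parts; matrices of full row rank\<close>

text \<open>Because the matrix is real, this lemma and the next split a complex eigenvalue equation
  into two equations between real vectors.\<close>

lemma map_vec_Re_mult_mat_vec:
  assumes "S \<in> carrier_mat nr nc" "v \<in> carrier_vec nc"
  shows "map_vec Re (map_mat complex_of_real S *\<^sub>v v) = S *\<^sub>v map_vec Re v"
  using assms by (intro eq_vecI) (auto simp: scalar_prod_def)

lemma map_vec_Im_mult_mat_vec:
  assumes "S \<in> carrier_mat nr nc" "v \<in> carrier_vec nc"
  shows "map_vec Im (map_mat complex_of_real S *\<^sub>v v) = S *\<^sub>v map_vec Im v"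
  using assms by (intro eq_vecI) (auto simp: scalar_prod_def)

lemma scalar_prod_self_nonneg:
  fixes v :: "real vec"
  shows "v \<bullet> v \<ge> 0"
  by (simp add: scalar_prod_def sum_nonneg)

text \<open>Rank \<open>m\<close> provides \<open>m\<close> independent columns of \<open>B\<close>.
  They form an invertible square matrix \<open>W\<close>, and a vector orthogonal to all columns of
  \<open>B\<close> is orthogonal to those of \<open>W\<close>, hence zero.\<close>

lemma transpose_full_row_rank_inj:
  fixes B :: "'a :: field mat"
  assumes B: "B \<in> carrier_mat m n" and rank: "vec_space.rank m B = m"
    and y: "y \<in> carrier_vec m" and By: "transpose_mat B *\<^sub>v y = 0\<^sub>v n"
  shows "y = 0\<^sub>v m"
proof (rule ccontr)
  assume y0: "y \<noteq> 0\<^sub>v m"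
  interpret vec_space "TYPE('a)" m .
  let ?P = "\<lambda>T. T \<subseteq> set (cols B) \<and> lin_indpt T"
  \<comment> \<open>A maximal independent set of columns exists because the empty set qualifies and
    there are finitely many columns; its cardinality is the rank.\<close>
  obtain S where S: "maximal S ?P"
    using maximal_exists[of ?P "card (set (cols B))" "{}"]
    by (meson List.finite_set card_mono empty_iff empty_subsetI finite_lin_indpt2 rev_finite_subset)
  have card: "card S = m"
    using rank_card_indpt[OF B S] rank by simp
  have SB: "S \<subseteq> set (cols B)" and li: "lin_indpt S"
    using S by (auto simp: maximal_def)
  have Sc: "S \<subseteq> carrier_vec m"
    using SB cols_dim[of B] B by auto
  obtain ws where ws: "set ws = S" "distinct ws"
    using finite_distinct_list[of S] SB finite_subset by blast
  have len: "length ws = m"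
    using card ws distinct_card by metis
  define W where "W = mat_of_cols m ws"
  have W: "W \<in> carrier_mat m m" unfolding W_def using mat_of_cols_carrier(1)[of m ws] len by simp
  have cW: "cols W = ws" unfolding W_def using Sc ws by simp
  have "rank W = m"
    using lin_indpt_full_rank[OF W] cW ws li by simp
  hence "det W \<noteq> 0" using det_rank_iff[OF W] by simp
  hence det: "det (transpose_mat W) \<noteq> 0" using det_transpose[OF W] by simp
  \<comment> \<open>Every column of \<open>W\<close> is some column of \<open>B\<close>, so each
    entry of this product is an entry of the zero vector
    \<open>transpose_mat B *\<^sub>v y\<close>.\<close>
  have "transpose_mat W *\<^sub>v y = 0\<^sub>v m"
  proof (rule eq_vecI)
    fix i assume "i < dim_vec (0\<^sub>v m :: 'a vec)"
    hence i: "i < m" by simp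
    have "col W i = cols W ! i" using i W by simp
    hence "col W i \<in> set (cols B)" using cW SB ws(1) len i nth_mem[of i ws] by (metis subsetD)
    then obtain j where j: "j < n" "col W i = col B j"
      using B by (auto simp: cols_def)
    have "(transpose_mat W *\<^sub>v y) $ i = col B j \<bullet> y" using i W j by simp
    also have "\<dots> = (transpose_mat B *\<^sub>v y) $ j" using B j by simp
    finally show "(transpose_mat W *\<^sub>v y) $ i = 0\<^sub>v m $ i" using By j i by simp
  qed (use W in auto)
  thus False
    using det det_0_iff_vec_prod_zero[of "transpose_mat W" m] W y y0 by auto
qed

section \<open>The spectrum of the saddle point matrix\<close>

lemma saddle_point_mat_mult_vec:
  assumes "A \<in> carrier_mat n n" "B \<in> carrier_mat m n" "C \<in> carrier_mat m n"
    and "x \<in> carrier_vec n" "y \<in> carrier_vec m"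
  shows "saddle_point_mat A B C *\<^sub>v (x @\<^sub>v y) =
    (A *\<^sub>v x + transpose_mat B *\<^sub>v y) @\<^sub>v (- (C *\<^sub>v x))"
proof -
  have "saddle_point_mat A B C *\<^sub>v (x @\<^sub>v y) =
    (A *\<^sub>v x + transpose_mat B *\<^sub>v y) @\<^sub>v ((- C) *\<^sub>v x + 0\<^sub>m m m *\<^sub>v y)"
    unfolding saddle_point_mat_def using assms
    by (subst four_block_mat_mult_vec[of _ n n _ m _ m]) auto
  also have "(- C) *\<^sub>v x + 0\<^sub>m m m *\<^sub>v y = - (C *\<^sub>v x)"
    using assms by (intro eq_vecI) auto
  finally show ?thesis .
qed

text \<open>The weight \<open>k\<close> turns the two off-diagonal contributions into
  \<open>k\<close> and \<open>-k\<close> times the same number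
  \<open>y \<bullet> (B *\<^sub>v x)\<close>, so they cancel. The image is left as an arbitrary pair
  \<open>u\<close>, \<open>w\<close> because the real part of an eigenvector need not be mapped to a
  multiple of itself.\<close>

lemma saddle_point_mat_weighted_form:
  fixes A B :: "real mat"
  assumes A: "A \<in> carrier_mat n n" and B: "B \<in> carrier_mat m n"
    and x: "x \<in> carrier_vec n" and y: "y \<in> carrier_vec m"
    and u: "u \<in> carrier_vec n" and w: "w \<in> carrier_vec m"
    and eq: "saddle_point_mat A B (k \<cdot>\<^sub>m B) *\<^sub>v (x @\<^sub>v y) = u @\<^sub>v w"
  shows "k * (x \<bullet> u) + y \<bullet> w = k * (x \<bullet> (A *\<^sub>v x))"
proof -
  have "(A *\<^sub>v x + transpose_mat B *\<^sub>v y) @\<^sub>v (- ((k \<cdot>\<^sub>m B) *\<^sub>v x)) = u @\<^sub>v w"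
    using eq saddle_point_mat_mult_vec[of A n B m "k \<cdot>\<^sub>m B" x y] A B x y by simp
  hence *: "u = A *\<^sub>v x + transpose_mat B *\<^sub>v y" "w = - ((k \<cdot>\<^sub>m B) *\<^sub>v x)"
    using append_vec_eq[of "A *\<^sub>v x + transpose_mat B *\<^sub>v y" n u] A B x y u by auto
  have "x \<bullet> u = x \<bullet> (A *\<^sub>v x) + x \<bullet> (transpose_mat B *\<^sub>v y)"
    unfolding * using A B x y by (intro scalar_prod_add_distrib) auto
  moreover have "x \<bullet> (transpose_mat B *\<^sub>v y) = y \<bullet> (B *\<^sub>v x)"
    using transpose_vec_mult_scalar[OF B x y] B x y
    by (metis comm_scalar_prod mult_mat_vec_carrier transpose_carrier_mat)
  moreover have "w = (- k) \<cdot>\<^sub>v (B *\<^sub>v x)"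
    unfolding * using B x by (intro eq_vecI) (auto simp: smult_scalar_prod_distrib)
  hence "y \<bullet> w = - k * (y \<bullet> (B *\<^sub>v x))"
    using B x y by simp
  ultimately show ?thesis by (simp add: algebra_simps)
qed

lemma saddle_point_mat_positive_stable:
  fixes A B :: "real mat"
  assumes A: "sym_pos_def n A" and B: "B \<in> carrier_mat m n"
    and rank: "vec_space.rank m B = m" and k: "k > 0"
    and ev: "eigenvalue (map_mat complex_of_real (saddle_point_mat A B (k \<cdot>\<^sub>m B))) \<mu>"
  shows "Re \<mu> > 0"
proof (rule ccontr)
  let ?S = "saddle_point_mat A B (k \<cdot>\<^sub>m B)"
  assume "\<not> Re \<mu> > 0"
  hence neg: "Re \<mu> \<le> 0" by simp
  have Ac: "A \<in> carrier_mat n n" using A by (auto simp: sym_pos_def_def)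
  have S: "?S \<in> carrier_mat (n + m) (n + m)"
    unfolding saddle_point_mat_def using Ac B by auto
  obtain v where v: "v \<in> carrier_vec (n + m)" "v \<noteq> 0\<^sub>v (n + m)"
    and Sv: "map_mat complex_of_real ?S *\<^sub>v v = \<mu> \<cdot>\<^sub>v v"
    using ev S by (auto simp: eigenvalue_def eigenvector_def)
  \<comment> \<open>The argument runs over the reals: the eigenvector is \<open>a + i b\<close>,
    with \<open>a\<close> and \<open>b\<close> cut into blocks of sizes \<open>n\<close> and
    \<open>m\<close>. With \<mu> written as \<open>p + i q\<close>, the eigenvalue equation becomes
    \<open>S a = p a - q b\<close> and \<open>S b = p b + q a\<close>.\<close>
  define a1 a2 b1 b2 where "a1 = vec_first (map_vec Re v) n" and "a2 = vec_last (map_vec Re v) m"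
    and "b1 = vec_first (map_vec Im v) n" and "b2 = vec_last (map_vec Im v) m"
  have c: "a1 \<in> carrier_vec n" "a2 \<in> carrier_vec m" "b1 \<in> carrier_vec n" "b2 \<in> carrier_vec m"
    unfolding a1_def a2_def b1_def b2_def by auto
  have a: "map_vec Re v = a1 @\<^sub>v a2" and b: "map_vec Im v = b1 @\<^sub>v b2"
    unfolding a1_def a2_def b1_def b2_def using v by auto
  define p q where "p = Re \<mu>" and "q = Im \<mu>"
  have "?S *\<^sub>v map_vec Re v = p \<cdot>\<^sub>v map_vec Re v - q \<cdot>\<^sub>v map_vec Im v"
    unfolding map_vec_Re_mult_mat_vec[OF S v(1), symmetric] Sv p_def q_def
    by (intro eq_vecI) auto
  hence Sa: "?S *\<^sub>v (a1 @\<^sub>v a2) = (p \<cdot>\<^sub>v a1 - q \<cdot>\<^sub>v b1) @\<^sub>v (p \<cdot>\<^sub>v a2 - q \<cdot>\<^sub>v b2)"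
    unfolding a b using c by (auto intro!: eq_vecI)
  have "?S *\<^sub>v map_vec Im v = p \<cdot>\<^sub>v map_vec Im v + q \<cdot>\<^sub>v map_vec Re v"
    unfolding map_vec_Im_mult_mat_vec[OF S v(1), symmetric] Sv p_def q_def
    by (intro eq_vecI) auto
  hence Sb: "?S *\<^sub>v (b1 @\<^sub>v b2) = (p \<cdot>\<^sub>v b1 + q \<cdot>\<^sub>v a1) @\<^sub>v (p \<cdot>\<^sub>v b2 + q \<cdot>\<^sub>v a2)"
    unfolding a b using c by (auto intro!: eq_vecI)
  have fa: "k * (p * (a1 \<bullet> a1) - q * (a1 \<bullet> b1)) + (p * (a2 \<bullet> a2) - q * (a2 \<bullet> b2)) =
      k * (a1 \<bullet> (A *\<^sub>v a1))"
    using saddle_point_mat_weighted_form[OF Ac B c(1,2) _ _ Sa] c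
    by (simp add: scalar_prod_minus_distrib)
  have fb: "k * (p * (b1 \<bullet> b1) + q * (a1 \<bullet> b1)) + (p * (b2 \<bullet> b2) + q * (a2 \<bullet> b2)) =
      k * (b1 \<bullet> (A *\<^sub>v b1))"
    using saddle_point_mat_weighted_form[OF Ac B c(3,4) _ _ Sb] c
    by (simp add: scalar_prod_add_distrib comm_scalar_prod[of b1 n a1] comm_scalar_prod[of b2 m a2])
  \<comment> \<open>Adding the forms for \<open>a\<close> and \<open>b\<close> removes the mixed
    products, which occur with the factors \<open>-q\<close> and \<open>q\<close>.\<close>
  have sum: "p * (k * (a1 \<bullet> a1 + b1 \<bullet> b1) + (a2 \<bullet> a2 + b2 \<bullet> b2)) =
      k * (a1 \<bullet> (A *\<^sub>v a1) + b1 \<bullet> (A *\<^sub>v b1))"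
    using fa fb by (simp add: algebra_simps)
  have nonneg: "x \<bullet> (A *\<^sub>v x) \<ge> 0" and definite: "x \<bullet> (A *\<^sub>v x) = 0 \<Longrightarrow> x = 0\<^sub>v n"
    if "x \<in> carrier_vec n" for x
    using A that Ac unfolding sym_pos_def_def
    by (cases "x = 0\<^sub>v n"; force)+
  \<comment> \<open>As \<open>p\<close> is not positive, the two nonnegative values of the form of
    \<open>A\<close> have a sum that is at most 0, so both vanish and definiteness applies.\<close>
  have "p * (k * (a1 \<bullet> a1 + b1 \<bullet> b1) + (a2 \<bullet> a2 + b2 \<bullet> b2)) \<le> 0"
    using neg k unfolding p_def
    by (intro mult_nonpos_nonneg add_nonneg_nonneg mult_nonneg_nonneg scalar_prod_self_nonneg) auto
  hence "a1 \<bullet> (A *\<^sub>v a1) + b1 \<bullet> (A *\<^sub>v b1) \<le> 0"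
    unfolding sum using k by (simp add: mult_le_0_iff)
  hence zero1: "a1 = 0\<^sub>v n" "b1 = 0\<^sub>v n"
    using nonneg[OF c(1)] nonneg[OF c(3)] definite[OF c(1)] definite[OF c(3)] by linarith+
  \<comment> \<open>Once the first block is zero on both sides, the first block row reads
    \<open>transpose_mat B *\<^sub>v y = 0\<^sub>v n\<close>. The second block \<open>w\<close>
    stays arbitrary, so that this serves both \<open>a2\<close> and \<open>b2\<close>.\<close>
  have zero2: "y = 0\<^sub>v m" if y: "y \<in> carrier_vec m"
    and eq: "?S *\<^sub>v (0\<^sub>v n @\<^sub>v y) = 0\<^sub>v n @\<^sub>v w" for y w
  proof (rule transpose_full_row_rank_inj[OF B rank y])
    have "(A *\<^sub>v 0\<^sub>v n + transpose_mat B *\<^sub>v y) @\<^sub>v (- ((k \<cdot>\<^sub>m B) *\<^sub>v 0\<^sub>v n)) = 0\<^sub>v n @\<^sub>v w"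
      using eq saddle_point_mat_mult_vec[of A n B m "k \<cdot>\<^sub>m B" "0\<^sub>v n" y] Ac B y by simp
    hence "A *\<^sub>v 0\<^sub>v n + transpose_mat B *\<^sub>v y = 0\<^sub>v n"
      using append_vec_eq[of "A *\<^sub>v 0\<^sub>v n + transpose_mat B *\<^sub>v y" n "0\<^sub>v n"] Ac B y by auto
    moreover have "A *\<^sub>v 0\<^sub>v n = 0\<^sub>v n" using Ac by (intro eq_vecI) auto
    ultimately show "transpose_mat B *\<^sub>v y = 0\<^sub>v n" using B y by simp
  qed
  have "p \<cdot>\<^sub>v a1 - q \<cdot>\<^sub>v b1 = 0\<^sub>v n" "p \<cdot>\<^sub>v b1 + q \<cdot>\<^sub>v a1 = 0\<^sub>v n" using zero1 by auto
  hence "a2 = 0\<^sub>v m" "b2 = 0\<^sub>v m"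
    using zero2[OF c(2)] zero2[OF c(4)] Sa Sb unfolding zero1 by metis+
  hence "map_vec Re v = 0\<^sub>v (n + m)" "map_vec Im v = 0\<^sub>v (n + m)"
    unfolding a b zero1 by auto
  hence "v = 0\<^sub>v (n + m)"
    using v(1) by (auto simp: vec_eq_iff complex_eq_iff)
  thus False using v by simp
qed

section \<open>Positive stable matrices and their shifts\<close>

text \<open>Interface between the two halves of the proof: from here on, the spectral and
  convergence arguments hold for any real matrix with this property, whatever its block
  structure.\<close>

definition positive_stable :: "real mat \<Rightarrow> bool" where
  "positive_stable S \<longleftrightarrow> (\<forall>\<mu>. eigenvalue (map_mat complex_of_real S) \<mu> \<longrightarrow> Re \<mu> > 0)"

text \<open>A nonzero \<open>v\<close> would be an eigenvector of \<open>S\<close> for the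
  eigenvalue -\<alpha>, which is not positive. The case \<alpha> = 0 is included so that both
  \<open>S\<close> itself and its positive shifts turn out to be nonsingular.\<close>

lemma positive_stable_kernel_shift:
  assumes S: "S \<in> carrier_mat N N" and ps: "positive_stable S" and "\<alpha> \<ge> 0"
    and v: "v \<in> carrier_vec N" and "\<alpha> \<cdot>\<^sub>v v + S *\<^sub>v v = 0\<^sub>v N"
  shows "v = 0\<^sub>v N"
proof (rule ccontr)
  assume "v \<noteq> 0\<^sub>v N"
  have "S *\<^sub>v v = (- \<alpha>) \<cdot>\<^sub>v v"
  proof (rule eq_vecI)
    fix i assume "i < dim_vec ((- \<alpha>) \<cdot>\<^sub>v v)"
    hence i: "i < N" using v by simp
    have "(\<alpha> \<cdot>\<^sub>v v + S *\<^sub>v v) $ i = 0" using assms(5) i by simp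
    thus "(S *\<^sub>v v) $ i = ((- \<alpha>) \<cdot>\<^sub>v v) $ i" using i S v by simp
  qed (use S v in auto)
  hence "eigenvalue S (- \<alpha>)"
    unfolding eigenvalue_def eigenvector_def using S v \<open>v \<noteq> 0\<^sub>v N\<close> by auto
  hence "eigenvalue (map_mat complex_of_real S) (of_real (- \<alpha>))"
    by (rule of_real_hom.eigenvalue_hom[OF S])
  thus False using ps \<open>\<alpha> \<ge> 0\<close> unfolding positive_stable_def by fastforce
qed

lemma positive_stable_det:
  assumes S: "S \<in> carrier_mat N N" and "positive_stable S"
  shows "det S \<noteq> 0"
proof
  assume "det S = 0"
  then obtain v where "v \<in> carrier_vec N" "v \<noteq> 0\<^sub>v N" "S *\<^sub>v v = 0\<^sub>v N"
    using det_0_iff_vec_prod_zero[OF S] by auto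
  moreover from this have "0 \<cdot>\<^sub>v v + S *\<^sub>v v = 0\<^sub>v N" by (intro eq_vecI) auto
  ultimately show False using positive_stable_kernel_shift[OF assms, of 0 v] by simp
qed

lemma shift_plus_carrier [simp]: "S \<in> carrier_mat N N \<Longrightarrow> shift_plus \<alpha> S \<in> carrier_mat N N"
  and shift_minus_carrier [simp]: "S \<in> carrier_mat N N \<Longrightarrow> shift_minus \<alpha> S \<in> carrier_mat N N"
  by (auto simp: shift_plus_def shift_minus_def)

lemma shift_plus_mult_vec:
  assumes "S \<in> carrier_mat N N" "v \<in> carrier_vec N"
  shows "shift_plus \<alpha> S *\<^sub>v v = \<alpha> \<cdot>\<^sub>v v + S *\<^sub>v v"
  unfolding shift_plus_def using assms
  by (subst add_mult_distrib_mat_vec[of _ N N]) auto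

lemma shift_minus_mult_vec:
  assumes "S \<in> carrier_mat N N" "v \<in> carrier_vec N"
  shows "shift_minus \<alpha> S *\<^sub>v v = \<alpha> \<cdot>\<^sub>v v - S *\<^sub>v v"
  unfolding shift_minus_def using assms
  by (subst minus_mult_distrib_mat_vec[of _ N N]) auto

lemma positive_stable_shift_plus_det:
  assumes S: "S \<in> carrier_mat N N" and "positive_stable S" "\<alpha> > 0"
  shows "det (shift_plus \<alpha> S) \<noteq> 0"
proof
  assume "det (shift_plus \<alpha> S) = 0"
  then obtain v where "v \<in> carrier_vec N" "v \<noteq> 0\<^sub>v N" "shift_plus \<alpha> S *\<^sub>v v = 0\<^sub>v N"
    using det_0_iff_vec_prod_zero[OF shift_plus_carrier[OF S]] by auto
  thus False using positive_stable_kernel_shift[OF assms(1,2), of \<alpha> v] assms(3)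
    by (auto simp: shift_plus_mult_vec[OF S])
qed

section \<open>The iteration matrix and its spectrum\<close>

lemma mat_inverse_det_nonzero:
  fixes M :: "'a :: field mat"
  assumes M: "M \<in> carrier_mat N N" and "det M \<noteq> 0"
  obtains R where "mat_inverse M = Some R" "M * R = 1\<^sub>m N" "R * M = 1\<^sub>m N" "R \<in> carrier_mat N N"
proof (cases "mat_inverse M")
  case None
  \<comment> \<open>The dummy parameter \<open>b\<close> of the matrix ring is fixed to
    \<open>()\<close> in both facts, so that they speak about units of the same ring.\<close>
  thus ?thesis using mat_inverse(1)[OF M None, where b = "()"] det_non_zero_imp_unit[OF assms, where b = "()"]
    by blast
next
  case (Some R)
  thus ?thesis using mat_inverse(2)[OF M Some] that by simp
qed

text \<open>Later arguments reach the iteration matrix only through these two facts and so avoid its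
  option-valued inverse.\<close>

lemma SS_iteration_mat_mult_left:
  assumes S: "S \<in> carrier_mat N N" and "det (shift_plus \<alpha> S) \<noteq> 0"
  shows "SS_iteration_mat \<alpha> S \<in> carrier_mat N N"
    and "shift_plus \<alpha> S * SS_iteration_mat \<alpha> S = shift_minus \<alpha> S"
proof -
  obtain R where R: "mat_inverse (shift_plus \<alpha> S) = Some R" "shift_plus \<alpha> S * R = 1\<^sub>m N"
      "R \<in> carrier_mat N N"
    using mat_inverse_det_nonzero[OF shift_plus_carrier[OF S] assms(2)] by metis
  have M: "SS_iteration_mat \<alpha> S = R * shift_minus \<alpha> S"
    unfolding SS_iteration_mat_def R(1) by simp
  show "SS_iteration_mat \<alpha> S \<in> carrier_mat N N" unfolding M using R S by auto
  have "shift_plus \<alpha> S * (R * shift_minus \<alpha> S) = (shift_plus \<alpha> S * R) * shift_minus \<alpha> S"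
    using assoc_mult_mat[of "shift_plus \<alpha> S" N N R N "shift_minus \<alpha> S" N] R(3) S by simp
  thus "shift_plus \<alpha> S * SS_iteration_mat \<alpha> S = shift_minus \<alpha> S"
    unfolding M R(2) using left_mult_one_mat[OF shift_minus_carrier[OF S]] by simp
qed

text \<open>The real part equals \<open>(1 - |\<mu>|^2) / |1 + \<mu>|^2\<close>, so its positivity
  forces a positive numerator. Since division by zero yields 0, the hypothesis already excludes
  \<mu> = -1.\<close>

lemma cmod_less_1_if_cayley_Re_pos:
  assumes "Re ((1 - \<mu>) / (1 + \<mu>)) > 0"
  shows "cmod \<mu> < 1"
proof -
  have "Re ((1 - \<mu>) / (1 + \<mu>)) = (1 - (cmod \<mu>)\<^sup>2) / ((cmod (1 + \<mu>))\<^sup>2)"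
    unfolding Re_divide cmod_power2 by (simp add: power2_eq_square algebra_simps)
  hence "(cmod \<mu>)\<^sup>2 < 1"
    using assms by (simp add: zero_less_divide_iff)
  thus ?thesis by (simp add: power2_eq_1_iff abs_square_less_1)
qed

lemma eigenvalue_SS_iteration_mat:
  assumes S: "S \<in> carrier_mat N N" and ps: "positive_stable S" and \<alpha>: "\<alpha> > 0"
    and ev: "eigenvalue (map_mat complex_of_real (SS_iteration_mat \<alpha> S)) \<mu>"
  shows "cmod \<mu> < 1"
proof -
  let ?c = "map_mat complex_of_real"
  note M = SS_iteration_mat_mult_left[OF S positive_stable_shift_plus_det[OF S ps \<alpha>]]
  obtain v where v: "v \<in> carrier_vec N" "v \<noteq> 0\<^sub>v N"
    and Mv: "?c (SS_iteration_mat \<alpha> S) *\<^sub>v v = \<mu> \<cdot>\<^sub>v v"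
    using ev M(1) by (auto simp: eigenvalue_def eigenvector_def)
  have cS: "?c S \<in> carrier_mat N N" using S by simp
  have plus: "?c (shift_plus \<alpha> S) *\<^sub>v v = of_real \<alpha> \<cdot>\<^sub>v v + ?c S *\<^sub>v v"
  proof -
    have "?c (shift_plus \<alpha> S) = of_real \<alpha> \<cdot>\<^sub>m 1\<^sub>m N + ?c S"
      unfolding shift_plus_def using S by (intro eq_matI) auto
    moreover have "(of_real \<alpha> \<cdot>\<^sub>m 1\<^sub>m N) *\<^sub>v v = of_real \<alpha> \<cdot>\<^sub>v v"
      using v by (intro eq_vecI) auto
    ultimately show ?thesis using cS v by (simp add: add_mult_distrib_mat_vec[of _ N N])
  qed
  have minus: "?c (shift_minus \<alpha> S) *\<^sub>v v = of_real \<alpha> \<cdot>\<^sub>v v - ?c S *\<^sub>v v"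
  proof -
    have "?c (shift_minus \<alpha> S) = of_real \<alpha> \<cdot>\<^sub>m 1\<^sub>m N - ?c S"
      unfolding shift_minus_def using S by (intro eq_matI) auto
    moreover have "(of_real \<alpha> \<cdot>\<^sub>m 1\<^sub>m N) *\<^sub>v v = of_real \<alpha> \<cdot>\<^sub>v v"
      using v by (intro eq_vecI) auto
    ultimately show ?thesis using cS v by (simp add: minus_mult_distrib_mat_vec[of _ N N])
  qed
  \<comment> \<open>Multiplying the eigenvalue equation by the plus shift gives
    \<open>(\<alpha> I - S) v = \<mu> (\<alpha> I + S) v\<close>, with no inverse left.\<close>
  have "?c (shift_minus \<alpha> S) = ?c (shift_plus \<alpha> S) * ?c (SS_iteration_mat \<alpha> S)"
    unfolding M(2)[symmetric] by (rule of_real_hom.mat_hom_mult[OF shift_plus_carrier[OF S] M(1)])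
  hence "?c (shift_minus \<alpha> S) *\<^sub>v v = ?c (shift_plus \<alpha> S) *\<^sub>v (\<mu> \<cdot>\<^sub>v v)"
    using Mv v M(1) S by (simp add: assoc_mult_mat_vec[of _ N N _ N])
  also have "\<dots> = \<mu> \<cdot>\<^sub>v (?c (shift_plus \<alpha> S) *\<^sub>v v)"
    using mult_mat_vec[of "?c (shift_plus \<alpha> S)" N N v \<mu>] v S by simp
  finally have eq: "of_real \<alpha> \<cdot>\<^sub>v v - ?c S *\<^sub>v v = \<mu> \<cdot>\<^sub>v (of_real \<alpha> \<cdot>\<^sub>v v + ?c S *\<^sub>v v)"
    unfolding plus minus .
  \<comment> \<open>The terms in \<open>S v\<close> are collected entrywise; removing
    \<open>index_mult_mat_vec\<close> from the simpset keeps the entries of \<open>S v\<close>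
    atomic.\<close>
  have eqi: "(1 + \<mu>) * (?c S *\<^sub>v v) $ i = of_real \<alpha> * (1 - \<mu>) * v $ i" if "i < N" for i
    using arg_cong[OF eq, of "\<lambda>w. w $ i"] that cS v
    by (simp add: algebra_simps del: index_mult_mat_vec)
  \<comment> \<open>For \<mu> = -1 the left side of \<open>eqi\<close> vanishes while the right side
    is \<open>2 \<alpha> v $ i\<close>, which would make \<open>v\<close> zero.\<close>
  have "1 + \<mu> \<noteq> 0"
  proof
    assume "1 + \<mu> = 0"
    hence "\<mu> = -1" by (simp add: add_eq_0_iff)
    hence "v $ i = 0" if "i < N" for i using eqi[OF that] \<alpha> by simp
    thus False using v by (auto simp: vec_eq_iff)
  qed
  have "?c S *\<^sub>v v = (of_real \<alpha> * ((1 - \<mu>) / (1 + \<mu>))) \<cdot>\<^sub>v v"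
  proof (rule eq_vecI)
    fix i assume "i < dim_vec ((of_real \<alpha> * ((1 - \<mu>) / (1 + \<mu>))) \<cdot>\<^sub>v v)"
    hence "i < N" using v by simp
    thus "(?c S *\<^sub>v v) $ i = ((of_real \<alpha> * ((1 - \<mu>) / (1 + \<mu>))) \<cdot>\<^sub>v v) $ i"
      using eqi[of i] \<open>1 + \<mu> \<noteq> 0\<close> v(1)
      by (simp add: field_simps del: index_mult_mat_vec)
  qed (use S v in auto)
  hence "eigenvalue (?c S) (of_real \<alpha> * ((1 - \<mu>) / (1 + \<mu>)))"
    unfolding eigenvalue_def eigenvector_def using S v by auto
  hence "Re (of_real \<alpha> * ((1 - \<mu>) / (1 + \<mu>))) > 0"
    using ps unfolding positive_stable_def by blast
  hence "\<alpha> * Re ((1 - \<mu>) / (1 + \<mu>)) > 0"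
    by (simp only: Re_complex_of_real Im_complex_of_real times_complex.sel)
  thus ?thesis using \<alpha> by (intro cmod_less_1_if_cayley_Re_pos) (simp add: zero_less_mult_iff)
qed

text \<open>For \<open>N > 0\<close> the spectral radius is attained at an eigenvalue, so the strict
  bound on single eigenvalues passes to it.\<close>

lemma real_spectral_radius_SS_iteration_mat:
  assumes S: "S \<in> carrier_mat N N" and "N > 0" and ps: "positive_stable S" and \<alpha>: "\<alpha> > 0"
  shows "real_spectral_radius (SS_iteration_mat \<alpha> S) < 1"
  using spectral_radius_mem_max(1)[of "map_mat complex_of_real (SS_iteration_mat \<alpha> S)" N]
    SS_iteration_mat_mult_left(1)[OF S positive_stable_shift_plus_det[OF S ps \<alpha>]] \<open>N > 0\<close>
    eigenvalue_SS_iteration_mat[OF S ps \<alpha>]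
  by (auto simp: real_spectral_radius_def spectrum_def)

section \<open>Decay of matrix powers\<close>

lemma pow_smult_mat:
  fixes A :: "'a :: comm_semiring_1 mat"
  assumes A: "A \<in> carrier_mat N N"
  shows "(c \<cdot>\<^sub>m A) ^\<^sub>m k = c ^ k \<cdot>\<^sub>m (A ^\<^sub>m k)"
proof (induction k)
  case 0
  show ?case using A by (intro eq_matI) auto
next
  case (Suc k)
  have "(c \<cdot>\<^sub>m A) ^\<^sub>m Suc k = (c ^ k \<cdot>\<^sub>m (A ^\<^sub>m k)) * (c \<cdot>\<^sub>m A)" using Suc by simp
  also have "\<dots> = c ^ Suc k \<cdot>\<^sub>m (A ^\<^sub>m k * A)"
    using A pow_carrier_mat[OF A, of k] by (intro eq_matI) (simp_all add: mult_ac)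
  finally show ?case by simp
qed

text \<open>The library only bounds the powers of a matrix of spectral radius below 1. Applying this
  to \<open>A\<close> divided by a number strictly between its spectral radius and 1 gives geometric decay.\<close>

lemma spectral_radius_less_1_pow_tendsto_0:
  assumes A: "A \<in> carrier_mat N N" and sr: "spectral_radius A < 1"
    and i: "i < N" and j: "j < N"
  shows "(\<lambda>k. (A ^\<^sub>m k) $$ (i, j)) \<longlonglongrightarrow> 0"
proof -
  have N: "N > 0" using i by simp
  define r where "r = (spectral_radius A + 1) / 2"
  \<comment> \<open>Nonnegativity makes the midpoint \<open>r\<close> positive, so dividing by it is
    legitimate even for spectral radius 0.\<close>
  have "spectral_radius A \<ge> 0" using spectral_radius_mem_max(1)[OF A N] by auto
  hence r: "0 < r" "r < 1" "spectral_radius A < r" using sr by (auto simp: r_def)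
  define D where "D = of_real (1 / r) \<cdot>\<^sub>m A"
  have D: "D \<in> carrier_mat N N" using A by (simp add: D_def)
  have AD: "A = of_real r \<cdot>\<^sub>m D" unfolding D_def using A r by (intro eq_matI) auto
  have "cmod \<mu> < 1" if "eigenvalue D \<mu>" for \<mu>
  proof -
    obtain v where v: "v \<in> carrier_vec N" "v \<noteq> 0\<^sub>v N" "D *\<^sub>v v = \<mu> \<cdot>\<^sub>v v"
      using \<open>eigenvalue D \<mu>\<close> D by (auto simp: eigenvalue_def eigenvector_def)
    have "A *\<^sub>v v = of_real r \<cdot>\<^sub>v (D *\<^sub>v v)"
      unfolding AD using D v(1) by (auto intro!: eq_vecI simp: smult_scalar_prod_distrib)
    hence "A *\<^sub>v v = (of_real r * \<mu>) \<cdot>\<^sub>v v"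
      using v by (simp add: smult_smult_assoc)
    hence "eigenvalue A (of_real r * \<mu>)"
      unfolding eigenvalue_def eigenvector_def using A v by auto
    hence "cmod (of_real r * \<mu>) \<le> spectral_radius A"
      by (intro spectral_radius_mem_max(2)[OF A N]) (simp add: spectrum_def)
    hence "r * cmod \<mu> \<le> spectral_radius A" using r(1) by (simp add: norm_mult)
    hence "r * cmod \<mu> < r" using r(3) by linarith
    thus ?thesis using r(1) by simp
  qed
  hence "spectral_radius D < 1"
    using spectral_radius_mem_max(1)[OF D N] by (auto simp: spectrum_def)
  \<comment> \<open>The bound \<open>c\<close> is uniform in \<open>k\<close>; rescaling multiplies
    it by \<open>r ^ k\<close>, which tends to 0.\<close>
  then obtain c where c: "\<And>k. norm_bound (D ^\<^sub>m k) c"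
    using spectral_radius_jnf_norm_bound_less_1_upper_triangular[OF D] by auto
  have pow: "A ^\<^sub>m k = of_real r ^ k \<cdot>\<^sub>m (D ^\<^sub>m k)" for k
    unfolding AD by (rule pow_smult_mat[OF D])
  have "cmod ((A ^\<^sub>m k) $$ (i, j)) \<le> c * r ^ k" for k
  proof -
    have Dk: "D ^\<^sub>m k \<in> carrier_mat N N" using D by simp
    have "cmod ((D ^\<^sub>m k) $$ (i, j)) \<le> c"
      using c[of k] i j unfolding norm_bound_def carrier_matD[OF Dk] by blast
    hence "r ^ k * cmod ((D ^\<^sub>m k) $$ (i, j)) \<le> r ^ k * c"
      using r by (intro mult_left_mono) auto
    moreover have "(A ^\<^sub>m k) $$ (i, j) = of_real r ^ k * (D ^\<^sub>m k) $$ (i, j)"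
      unfolding pow using carrier_matD[OF Dk] i j by (intro index_smult_mat(1)) simp_all
    ultimately show ?thesis using r by (simp add: norm_mult norm_power mult.commute)
  qed
  hence "\<forall>\<^sub>F k in sequentially. cmod ((A ^\<^sub>m k) $$ (i, j)) \<le> norm (r ^ k) * c"
    using r by (simp add: mult.commute)
  thus ?thesis
    using tendsto_0_le[OF LIMSEQ_realpow_zero[of r]] r by simp
qed

text \<open>Powers commute with the embedding into the complex numbers, so the entries of the real
  powers decay too; a component of the product is a finite sum of such entries with fixed
  weights.\<close>

lemma real_spectral_radius_less_1_pow_mult_vec_tendsto_0:
  assumes M: "M \<in> carrier_mat N N" and sr: "real_spectral_radius M < 1"
    and e: "e \<in> carrier_vec N" and i: "i < N"
  shows "(\<lambda>k. ((M ^\<^sub>m k) *\<^sub>v e) $ i) \<longlonglongrightarrow> 0"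
proof -
  have lim: "(\<lambda>k. (M ^\<^sub>m k) $$ (i, j)) \<longlonglongrightarrow> 0" if j: "j < N" for j
  proof -
    have "(\<lambda>k. (map_mat complex_of_real M ^\<^sub>m k) $$ (i, j)) \<longlonglongrightarrow> 0"
      using spectral_radius_less_1_pow_tendsto_0[of "map_mat complex_of_real M" N] M sr i j
      by (simp add: real_spectral_radius_def)
    moreover have "(map_mat complex_of_real M ^\<^sub>m k) $$ (i, j) = of_real ((M ^\<^sub>m k) $$ (i, j))" for k
      unfolding of_real_hom.mat_hom_pow[OF M, symmetric]
      using pow_carrier_mat[OF M, of k] i j by (intro index_map_mat(1)) auto
    ultimately show ?thesis
      using tendsto_Re[of "\<lambda>k. complex_of_real ((M ^\<^sub>m k) $$ (i, j))" 0] by simp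
  qed
  have "((M ^\<^sub>m k) *\<^sub>v e) $ i = (\<Sum>j<N. (M ^\<^sub>m k) $$ (i, j) * e $ j)" for k
  proof -
    have Mk: "M ^\<^sub>m k \<in> carrier_mat N N" using M by simp
    have "((M ^\<^sub>m k) *\<^sub>v e) $ i = row (M ^\<^sub>m k) i \<bullet> e"
      using carrier_matD[OF Mk] i by (intro index_mult_mat_vec) simp
    also have "\<dots> = (\<Sum>j<N. row (M ^\<^sub>m k) i $ j * e $ j)"
      using e by (simp add: scalar_prod_def atLeast0LessThan)
    also have "\<dots> = (\<Sum>j<N. (M ^\<^sub>m k) $$ (i, j) * e $ j)"
      using carrier_matD[OF Mk] i by (intro sum.cong refl arg_cong2[of _ _ _ _ "(*)"] index_row(1)) simp_all
    finally show ?thesis .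
  qed
  moreover have "(\<lambda>k. \<Sum>j<N. (M ^\<^sub>m k) $$ (i, j) * e $ j) \<longlonglongrightarrow> 0"
    using lim by (intro tendsto_null_sum tendsto_mult_left_zero) auto
  ultimately show ?thesis by simp
qed

section \<open>Convergence of the iteration\<close>

text \<open>Writing the right-hand side as \<open>S *\<^sub>v xs\<close> makes \<open>xs\<close> a
  fixed point of the iteration, so the error is multiplied by the iteration matrix in each
  step.\<close>

lemma SS_iteration_tendsto:
  assumes S: "S \<in> carrier_mat N N" and det: "det (shift_plus \<alpha> S) \<noteq> 0"
    and sr: "real_spectral_radius (SS_iteration_mat \<alpha> S) < 1"
    and xs: "xs \<in> carrier_vec N" and it: "SS_iteration \<alpha> S (S *\<^sub>v xs) x0 x"
  shows "vec_tendsto x xs"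
proof -
  let ?M = "SS_iteration_mat \<alpha> S" and ?P = "shift_plus \<alpha> S"
  note M = SS_iteration_mat_mult_left[OF S det]
  have xc: "x k \<in> carrier_vec N" for k using it S by (auto simp: SS_iteration_def)
  have step: "?P *\<^sub>v x (Suc k) = shift_minus \<alpha> S *\<^sub>v x k + 2 \<cdot>\<^sub>v (S *\<^sub>v xs)" for k
    using it by (simp add: SS_iteration_def)
  have P: "?P \<in> carrier_mat N N" using S by simp
  obtain R where R: "R * ?P = 1\<^sub>m N" "R \<in> carrier_mat N N"
    using mat_inverse_det_nonzero[OF P det] by metis
  \<comment> \<open>The recurrence is implicit in the next iterate; injectivity of the plus shift
    lets the error equation be checked after applying it.\<close>
  have inj: "u = w" if "u \<in> carrier_vec N" "w \<in> carrier_vec N" "?P *\<^sub>v u = ?P *\<^sub>v w" for u w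
  proof -
    have "R *\<^sub>v (?P *\<^sub>v u) = R *\<^sub>v (?P *\<^sub>v w)" using that by simp
    thus ?thesis
      unfolding assoc_mult_mat_vec[OF R(2) P that(1), symmetric]
        assoc_mult_mat_vec[OF R(2) P that(2), symmetric] R(1) using that by simp
  qed
  have err: "x (Suc k) - xs = ?M *\<^sub>v (x k - xs)" for k
  proof (rule inj)
    have e: "x k - xs \<in> carrier_vec N" using xc xs by simp
    show "x (Suc k) - xs \<in> carrier_vec N" "?M *\<^sub>v (x k - xs) \<in> carrier_vec N"
      using xc xs M(1) e by auto
    have "?P *\<^sub>v (x (Suc k) - xs) = ?P *\<^sub>v x (Suc k) - ?P *\<^sub>v xs"
      by (rule mult_minus_distrib_mat_vec[OF P xc xs])
    \<comment> \<open>The fixed point identity: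
      \<open>2 S xs - (\<alpha> xs + S xs) = - (\<alpha> xs - S xs)\<close>.\<close>
    also have "\<dots> = shift_minus \<alpha> S *\<^sub>v x k - shift_minus \<alpha> S *\<^sub>v xs"
      unfolding step shift_minus_mult_vec[OF S xc] shift_minus_mult_vec[OF S xs]
        shift_plus_mult_vec[OF S xs]
      using S xs xc by (intro eq_vecI) (auto simp del: index_mult_mat_vec)
    also have "\<dots> = shift_minus \<alpha> S *\<^sub>v (x k - xs)"
      by (rule mult_minus_distrib_mat_vec[OF shift_minus_carrier[OF S] xc xs, symmetric])
    also have "\<dots> = ?P *\<^sub>v (?M *\<^sub>v (x k - xs))"
      unfolding M(2)[symmetric] by (rule assoc_mult_mat_vec[OF P M(1) e])
    finally show "?P *\<^sub>v (x (Suc k) - xs) = ?P *\<^sub>v (?M *\<^sub>v (x k - xs))" .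
  qed
  have e0: "x 0 - xs \<in> carrier_vec N" using xc xs by simp
  \<comment> \<open>Matrix powers grow by a factor on the right, next to the vector, so the
    induction peels off the earliest step and needs an arbitrary starting index
    \<open>l\<close>.\<close>
  have pow: "x (k + l) - xs = (?M ^\<^sub>m k) *\<^sub>v (x l - xs)" for k l
  proof (induction k arbitrary: l)
    case 0
    show ?case using M(1) xc[of l] xs by simp
  next
    case (Suc k)
    have e: "x l - xs \<in> carrier_vec N" using xc xs by simp
    have "x (Suc k + l) - xs = (?M ^\<^sub>m k) *\<^sub>v (?M *\<^sub>v (x l - xs))"
      using Suc[of "Suc l"] err[of l] by simp
    also have "\<dots> = (?M ^\<^sub>m k * ?M) *\<^sub>v (x l - xs)"
      by (rule assoc_mult_mat_vec[OF pow_carrier_mat[OF M(1)] M(1) e, symmetric])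
    finally show ?case by simp
  qed
  have "(\<lambda>k. x k $ i) \<longlonglongrightarrow> xs $ i" if i: "i < N" for i
  proof -
    have "x k $ i - xs $ i = ((?M ^\<^sub>m k) *\<^sub>v (x 0 - xs)) $ i" for k
      using arg_cong[OF pow[of k 0], of "\<lambda>w. w $ i"] i xs by simp
    hence "(\<lambda>k. x k $ i - xs $ i) \<longlonglongrightarrow> 0"
      using real_spectral_radius_less_1_pow_mult_vec_tendsto_0[OF M(1) sr e0 i] by simp
    thus ?thesis by (rule LIM_zero_cancel)
  qed
  thus ?thesis using xc xs by (auto simp: vec_tendsto_def)
qed

section \<open>Application to the saddle point matrix\<close>

theorem theorem2:
  fixes n m :: nat and A B C :: "real mat" and k :: real
  assumes "0 < n" and "m \<le> n"
    and "sym_pos_def n A"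
    and "B \<in> carrier_mat m n" and "C \<in> carrier_mat m n"
    and "vec_space.rank m B = m" and "vec_space.rank m C = m"
    and "k > 0" and "C = k \<cdot>\<^sub>m B"
  shows "(\<forall>\<alpha>>0. invertible_mat (shift_plus \<alpha> (saddle_point_mat A B C)) \<and>
            real_spectral_radius (SS_iteration_mat \<alpha> (saddle_point_mat A B C)) < 1) \<and>
         (\<forall>f \<in> carrier_vec (n + m).
            \<exists>xs \<in> carrier_vec (n + m).
              saddle_point_mat A B C *\<^sub>v xs = f \<and>
              (\<forall>y \<in> carrier_vec (n + m). saddle_point_mat A B C *\<^sub>v y = f \<longrightarrow> y = xs) \<and>
              (\<forall>\<alpha>>0. \<forall>x0 \<in> carrier_vec (n + m). \<forall>x.
                 SS_iteration \<alpha> (saddle_point_mat A B C) f x0 x \<longrightarrow> vec_tendsto x xs))"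
proof -
  define S where "S = saddle_point_mat A B C"
  define N where "N = n + m"
  have S: "S \<in> carrier_mat N N"
    unfolding S_def N_def saddle_point_mat_def using assms(3,4,5) by (auto simp: sym_pos_def_def)
  have N: "N > 0" using assms(1) by (simp add: N_def)
  have ps: "positive_stable S"
    unfolding positive_stable_def S_def assms(9)
    using saddle_point_mat_positive_stable[OF assms(3,4,6,8)] by blast
  note det = positive_stable_shift_plus_det[OF S ps]
    and sr = real_spectral_radius_SS_iteration_mat[OF S N ps]
  have inv: "invertible_mat (shift_plus \<alpha> S)" if \<alpha>: "\<alpha> > 0" for \<alpha>
  proof -
    have P: "shift_plus \<alpha> S \<in> carrier_mat N N" using S by simp
    obtain R where "shift_plus \<alpha> S * R = 1\<^sub>m N" "R * shift_plus \<alpha> S = 1\<^sub>m N" "R \<in> carrier_mat N N"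
      using mat_inverse_det_nonzero[OF P det[OF \<alpha>]] by metis
    thus ?thesis
      using P unfolding invertible_mat_def inverts_mat_def by (auto intro!: exI[of _ R])
  qed
  obtain R where R: "S * R = 1\<^sub>m N" "R * S = 1\<^sub>m N" "R \<in> carrier_mat N N"
    using mat_inverse_det_nonzero[OF S positive_stable_det[OF S ps]] by metis
  have sol: "\<exists>xs \<in> carrier_vec N. S *\<^sub>v xs = f \<and>
      (\<forall>y \<in> carrier_vec N. S *\<^sub>v y = f \<longrightarrow> y = xs) \<and>
      (\<forall>\<alpha>>0. \<forall>x0 \<in> carrier_vec N. \<forall>x. SS_iteration \<alpha> S f x0 x \<longrightarrow> vec_tendsto x xs)"
    if f: "f \<in> carrier_vec N" for f
  \<comment> \<open>The witness comes from the inverse of \<open>S\<close> alone, so one limit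
    serves every \<alpha> and every initial vector.\<close>
  proof (intro bexI[of _ "R *\<^sub>v f"] conjI ballI allI impI)
    show Rf: "R *\<^sub>v f \<in> carrier_vec N" using R f by simp
    show eq: "S *\<^sub>v (R *\<^sub>v f) = f"
      using assoc_mult_mat_vec[OF S R(3) f] R(1) f by simp
    show "y = R *\<^sub>v f" if "y \<in> carrier_vec N" "S *\<^sub>v y = f" for y
      using assoc_mult_mat_vec[OF R(3) S that(1)] R(2) that by simp
    show "vec_tendsto x (R *\<^sub>v f)" if "\<alpha> > 0" "SS_iteration \<alpha> S f x0 x" for \<alpha> x0 x
      using SS_iteration_tendsto[OF S det sr Rf] that eq by metis
  qed
  show ?thesis
    using inv sr sol unfolding S_def N_def by blast
qed

end
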